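(* Fix $\rho,\sigma>0$ and assume $$\lim_{N\to\infty}\inf_{r+s\ge N}Q_{r,s}^{\frac1{r+s}}>0\quad\text{and}\quad\lim_{N\to\infty}\sup_{r+s\ge N}Q_{r,s}^{\frac1{r+s}}<\infty .$$ Let $(z,w)\in\mathcal E$, $z,w>0$, be the unique pair satisfying $$\ln\Big(\frac zu\Big)\big(\rho-\rho(\bar c^{z,w})\big)+\ln\Big(\frac wv\Big)\big(\sigma-\sigma(\bar c^{z,w})\big)\ge0\quad\text{for all } u,v>0\text{ with }(u,v)\in\mathcal E.$$ Then, for any $\varepsilon>0$, there exist $M<\infty$ and $\delta_1,\delta_2>0$ such that for any $N\in\mathbb N$ and any $c\in X^+_{\rho,\sigma}$ with $c_{1,0},c_{0,1}>0$ and $\sum_{r+s\ge N+1}(r+s)c_{r,s}\le\delta_2$, setting $\bar c_{r,s}=c_{1,0}^r\,c_{0,1}^s\,Q_{r,s}$ and $$\Gamma=\Big\{(r,s)\in\Omega : r+s\le M,\ \text{or}\ r+s\le N\ \text{with}\ \ln\big(\bar c_{r,s}^{\frac1{r+s}}\big)<-\delta_1\Big\},$$ we have $$H^\Gamma[c|\bar c]\ge H[c|\bar c^{z,w}]+H^\Gamma[\bar c^\Gamma(\rho^N,\sigma^N)|\bar c]-\varepsilon,$$ where $\rho^N=\sum_{1\le r+s\le N}r\,c_{r,s}$ and $\sigma^N=\sum_{1\le r+s\le N}s\,c_{r,s}$.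
   Context: $\Omega=\{(r,s)\in\mathbb N_0^2 : r+s\ge1\}$, and $Q_{r,s}>0$, $(r,s)\in\Omega$, are given positive numbers with $Q_{1,0}=Q_{0,1}=1$. For $z,w\ge0$ let $\bar c^{z,w}_{r,s}=z^rw^sQ_{r,s}$. For a nonnegative sequence $c$ on $\Omega$, $\rho(c)=\sum_{(r,s)\in\Omega}r\,c_{r,s}$ and $\sigma(c)=\sum_{(r,s)\in\Omega}s\,c_{r,s}$. The region of existence is $\mathcal E=\{(z,w): z\ge0,\ w\ge0,\ \rho(\bar c^{z,w})+\sigma(\bar c^{z,w})<\infty\}$. (The assumption on $Q$ in the claim implies that $\mathcal E$ contains a pair with both entries positive, and then the pair $(z,w)$ in the claim is known to exist and be unique.) $X^+$ is the set of nonnegative sequences $c=(c_{r,s})_{(r,s)\in\Omega}$ with $\sum_{(r,s)\in\Omega}(r+s)c_{r,s}<\infty$, and $X^+_{\rho,\sigma}=\{c\in X^+: \rho(c)=\rho,\ \sigma(c)=\sigma\}$. Let $\Psi(x)=x\ln x+1-x\ge0$, $\Psi(0)=1$. For $z,w>0$ with $(z,w)\in\mathcal E$ and $c\in X^+$, $H[c|\bar c^{z,w}]=\sum_{(r,s)\in\Omega}\bar c^{z,w}_{r,s}\Psi\big(c_{r,s}/\bar c^{z,w}_{r,s}\big)$. For finite $\Gamma\subset\Omega$, a nonnegative sequence $d$ and a positive sequence $e$ on $\Gamma$, $H^\Gamma[d|e]=\sum_{(r,s)\in\Gamma}e_{r,s}\Psi\big(d_{r,s}/e_{r,s}\big)$.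 For finite $\Gamma\subset\Omega$ with $(1,0),(0,1)\in\Gamma$ and $\rho',\sigma'\ge0$, $\bar c^\Gamma(\rho',\sigma')$ denotes the finite steady state $(z'^r w'^s Q_{r,s})_{(r,s)\in\Gamma}$ where $z',w'\ge0$ is the unique pair (known to exist) with $\sum_{(r,s)\in\Gamma}r\,z'^rw'^sQ_{r,s}=\rho'$ and $\sum_{(r,s)\in\Gamma}s\,z'^rw'^sQ_{r,s}=\sigma'$. *)

theory Defs
  imports "HOL-Analysis.Analysis"
begin

(* A sequence indexed by Omega is a total function nat * nat => real; its value at (0,0) is
   irrelevant, since every definition below only looks at indices in Omega. *)
definition Omega :: "(nat \<times> nat) set" where
  "Omega = {(r, s). r + s \<ge> 1}"

definition cbar :: "(nat \<times> nat \<Rightarrow> real) \<Rightarrow> real \<Rightarrow> real \<Rightarrow> nat \<times> nat \<Rightarrow> real" where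
  "cbar Q z w = (\<lambda>(r, s). z ^ r * w ^ s * Q (r, s))"

(* Real-valued, so these are only meaningful where the sums converge; convergence is demanded
   explicitly in existence_region and X_plus. *)
definition rho_of :: "(nat \<times> nat \<Rightarrow> real) \<Rightarrow> real" where
  "rho_of c = (\<Sum>\<^sub>\<infinity>(r, s)\<in>Omega. real r * c (r, s))"

definition sigma_of :: "(nat \<times> nat \<Rightarrow> real) \<Rightarrow> real" where
  "sigma_of c = (\<Sum>\<^sub>\<infinity>(r, s)\<in>Omega. real s * c (r, s))"

(* All terms are nonnegative, so finiteness of both sums is summability. *)
definition existence_region :: "(nat \<times> nat \<Rightarrow> real) \<Rightarrow> (real \<times> real) set" where
  "existence_region Q = {(z, w). z \<ge> 0 \<and> w \<ge> 0 \<and>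
     (\<lambda>(r, s). real r * cbar Q z w (r, s)) summable_on Omega \<and>
     (\<lambda>(r, s). real s * cbar Q z w (r, s)) summable_on Omega}"

definition X_plus :: "(nat \<times> nat \<Rightarrow> real) set" where
  "X_plus = {c. (\<forall>p\<in>Omega. c p \<ge> 0) \<and>
     (\<lambda>(r, s). real (r + s) * c (r, s)) summable_on Omega}"

definition X_plus_at :: "real \<Rightarrow> real \<Rightarrow> (nat \<times> nat \<Rightarrow> real) set" where
  "X_plus_at \<rho> \<sigma> = {c \<in> X_plus. rho_of c = \<rho> \<and> sigma_of c = \<sigma>}"

definition Psi :: "real \<Rightarrow> real" where
  "Psi x = (if x = 0 then 1 else x * ln x + 1 - x)"

(* The sum is taken in the extended reals, so it is defined (possibly as infinity) for every
   nonnegative c and positive e. *)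
definition H :: "(nat \<times> nat \<Rightarrow> real) \<Rightarrow> (nat \<times> nat \<Rightarrow> real) \<Rightarrow> ereal" where
  "H c e = (\<Sum>\<^sub>\<infinity>p\<in>Omega. ereal (e p * Psi (c p / e p)))"

definition H_fin :: "(nat \<times> nat) set \<Rightarrow> (nat \<times> nat \<Rightarrow> real) \<Rightarrow> (nat \<times> nat \<Rightarrow> real) \<Rightarrow> real" where
  "H_fin \<Gamma> d e = (\<Sum>p\<in>\<Gamma>. e p * Psi (d p / e p))"

(* The pair selected by THE exists uniquely when \<Gamma> is a finite subset of Omega containing (1,0)
   and (0,1), Q is positive on Omega, and \<rho>', \<sigma>' are nonnegative. *)
definition cbar_fin ::
  "(nat \<times> nat \<Rightarrow> real) \<Rightarrow> (nat \<times> nat) set \<Rightarrow> real \<Rightarrow> real \<Rightarrow> nat \<times> nat \<Rightarrow> real" where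
  "cbar_fin Q \<Gamma> \<rho>' \<sigma>' =
     (let (z', w') = (THE (z', w'). z' \<ge> 0 \<and> w' \<ge> 0 \<and>
            (\<Sum>(r, s)\<in>\<Gamma>. real r * (z' ^ r * w' ^ s * Q (r, s))) = \<rho>' \<and>
            (\<Sum>(r, s)\<in>\<Gamma>. real s * (z' ^ r * w' ^ s * Q (r, s))) = \<sigma>')
      in cbar Q z' w')"

definition Gamma_set ::
  "(nat \<times> nat \<Rightarrow> real) \<Rightarrow> nat \<Rightarrow> nat \<Rightarrow> real \<Rightarrow> (nat \<times> nat) set" where
  "Gamma_set b M N \<delta> = {(r, s) \<in> Omega. r + s \<le> M \<or>
     (r + s \<le> N \<and> ln (b (r, s) powr (1 / real (r + s))) < - \<delta>)}"

definition rho_upto :: "nat \<Rightarrow> (nat \<times> nat \<Rightarrow> real) \<Rightarrow> real" where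
  "rho_upto N c = (\<Sum>(r, s) | 1 \<le> r + s \<and> r + s \<le> N. real r * c (r, s))"

definition sigma_upto :: "nat \<Rightarrow> (nat \<times> nat \<Rightarrow> real) \<Rightarrow> real" where
  "sigma_upto N c = (\<Sum>(r, s) | 1 \<le> r + s \<and> r + s \<le> N. real s * c (r, s))"

end

theory Submission
  imports Defs
begin

text \<open>In the logarithmic variables \<open>x = ln u\<close>, \<open>y = ln v\<close> every steady state is governed by the
  convex function \<open>F\<^sub>G(x, y) = (\<Sum>p\<in>G. cbar Q u v p) - \<rho> * x - \<sigma> * y\<close>. The variational
  inequality says that \<open>(ln z, ln w)\<close> minimizes it for \<open>G = Omega\<close>. By coercivity and compactness
  its truncations to \<open>r + s \<le> M\<close>, with slightly perturbed \<open>\<rho>\<close> and \<open>\<sigma>\<close>, are bounded below by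
  this minimum up to \<open>\<epsilon>\<close> once \<open>M\<close> is large. Writing all the entropies out, outside \<open>\<Gamma>\<close> one only
  needs \<open>c * ln c \<le> 0\<close>, the lower bound \<open>- \<delta>1\<close> on the exponents (if \<open>r + s \<le> N\<close>) and the lower
  bound on \<open>Q\<close> (if \<open>r + s > N\<close>); the terms containing \<open>ln (c (1, 0))\<close> and \<open>ln (c (0, 1))\<close> then
  cancel up to an error of order \<open>\<delta>2\<close>, and what remains is the comparison of \<open>F\<close> at the finite
  steady state with the minimum.\<close>

section \<open>Free energy, entropy density and coercivity\<close>

text \<open>Over an infinite \<open>G\<close> the sum takes the default value 0 when it diverges, so
  the value is meaningful only together with summability of \<open>cbar\<close>.\<close>

definition free_energy ::
  "(nat \<times> nat \<Rightarrow> real) \<Rightarrow> (nat \<times> nat) set \<Rightarrow> real \<Rightarrow> real \<Rightarrow> real \<Rightarrow> real \<Rightarrow> real" where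
  "free_energy Q G \<rho> \<sigma> x y = (\<Sum>\<^sub>\<infinity>p\<in>G. cbar Q (exp x) (exp y) p) - \<rho> * x - \<sigma> * y"

lemma free_energy_finite:
  "finite G \<Longrightarrow> free_energy Q G \<rho> \<sigma> x y = sum (cbar Q (exp x) (exp y)) G - \<rho> * x - \<sigma> * y"
  by (simp add: free_energy_def)

text \<open>The inequality \<open>ln t \<le> t - 1\<close> at \<open>t = 1 / x\<close>, multiplied
  by \<open>x\<close>.\<close>

lemma Psi_nonneg:
  assumes "x \<ge> 0"
  shows "Psi x \<ge> 0"
proof (cases "x = 0")
  case False
  with assms have "x > 0" by simp
  have "ln (inverse x) \<le> inverse x - 1"
    using \<open>x > 0\<close> by (intro ln_le_minus_one) simp
  then have "x * - ln x \<le> x * (inverse x - 1)"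
    using \<open>x > 0\<close> by (intro mult_left_mono) (auto simp: ln_inverse)
  with \<open>x > 0\<close> show ?thesis by (simp add: Psi_def algebra_simps)
qed (simp add: Psi_def)

text \<open>The logarithm of the quotient splits for \<open>c > 0\<close>; at \<open>c = 0\<close>
  the factor \<open>c\<close> annihilates the logarithms, and both sides equal
  \<open>e\<close>.\<close>

lemma mult_Psi_divide:
  assumes "e > 0" "c \<ge> 0"
  shows "e * Psi (c / e) = c * (ln c - ln e) + e - c"
  using assms by (cases "c = 0") (auto simp: Psi_def ln_div field_simps)

lemma cbar_exp:
  "cbar Q (exp x) (exp y) p = exp (real (fst p) * x + real (snd p) * y) * Q p"
  by (cases p) (simp add: cbar_def exp_add exp_of_nat_mult)

lemma cbar_pos:
  assumes "Q p > 0" "z > 0" "w > 0"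
  shows "cbar Q z w p > 0"
  using assms by (cases p) (simp add: cbar_def)

lemma ln_cbar:
  assumes "Q p > 0" "z > 0" "w > 0"
  shows "ln (cbar Q z w p) = real (fst p) * ln z + real (snd p) * ln w + ln (Q p)"
  using assms by (cases p) (simp add: cbar_def ln_mult ln_realpow)

text \<open>For \<open>x \<ge> 0\<close> the tangent of \<open>exp\<close> at
  \<open>ln (2 * \<kappa>\<^sub>1)\<close> has slope \<open>2 * \<kappa>\<^sub>1\<close>, enough to
  pay for both linear terms; for \<open>x < 0\<close> the term \<open>- \<kappa> * x\<close>
  suffices. The bound is uniform in \<open>\<kappa>\<close>, so that it applies to masses that vary
  along a sequence.\<close>

lemma linear_minus_const_le_exp_minus_linear:
  fixes x :: real
  assumes "0 < \<kappa>\<^sub>0" "\<kappa>\<^sub>0 \<le> \<kappa>" "\<kappa> \<le> \<kappa>\<^sub>1"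
  shows "\<kappa>\<^sub>0 * \<bar>x\<bar> - 2 * \<kappa>\<^sub>1 * \<bar>1 - ln (2 * \<kappa>\<^sub>1)\<bar> \<le> exp x - \<kappa> * x"
proof (cases "x \<ge> 0")
  case True
  have "2 * \<kappa>\<^sub>1 * (1 + (x - ln (2 * \<kappa>\<^sub>1))) \<le> 2 * \<kappa>\<^sub>1 * exp (x - ln (2 * \<kappa>\<^sub>1))"
    using assms by (intro mult_left_mono) auto
  also have "\<dots> = exp x"
    using assms by (simp add: exp_diff)
  finally have "2 * \<kappa>\<^sub>1 * x + 2 * \<kappa>\<^sub>1 * (1 - ln (2 * \<kappa>\<^sub>1)) \<le> exp x"
    by (simp add: algebra_simps)
  moreover have "2 * \<kappa>\<^sub>1 * - \<bar>1 - ln (2 * \<kappa>\<^sub>1)\<bar> \<le> 2 * \<kappa>\<^sub>1 * (1 - ln (2 * \<kappa>\<^sub>1))"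
    using assms by (intro mult_left_mono) auto
  moreover have "\<kappa>\<^sub>0 * x \<le> \<kappa>\<^sub>1 * x" "\<kappa> * x \<le> \<kappa>\<^sub>1 * x"
    using assms True by (auto intro!: mult_right_mono)
  ultimately show ?thesis using True by (simp add: algebra_simps)
next
  case False
  have "\<kappa>\<^sub>0 * \<bar>x\<bar> \<le> \<kappa> * \<bar>x\<bar>"
    using assms by (intro mult_right_mono) auto
  moreover have "0 \<le> 2 * \<kappa>\<^sub>1 * \<bar>1 - ln (2 * \<kappa>\<^sub>1)\<bar>" "0 < exp x"
    using assms by auto
  ultimately show ?thesis using False by (smt (verit) mult_minus_right)
qed

text \<open>The two monomer terms alone already provide the growth that makes the free energy
  coercive.\<close>

lemma exp_add_exp_le_sum_cbar:
  assumes "finite G" "(1, 0) \<in> G" "(0, 1) \<in> G" "\<forall>p\<in>G. Q p > 0"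
    and "Q (1, 0) = 1" "Q (0, 1) = 1"
  shows "exp x + exp y \<le> sum (cbar Q (exp x) (exp y)) G"
proof -
  have "sum (cbar Q (exp x) (exp y)) {(1, 0), (0, 1)} \<le> sum (cbar Q (exp x) (exp y)) G"
    using assms by (intro sum_mono2) (auto intro!: less_imp_le cbar_pos)
  then show ?thesis using assms by (simp add: cbar_def)
qed

section \<open>Steady states on finite index sets\<close>

text \<open>The two moment equations say that the gradient of
  \<open>free_energy Q G \<rho> \<sigma>\<close> vanishes at \<open>(x, y)\<close>. By coercivity
  and continuity this function attains its minimum over the plane, and the minimizer is such a
  point.\<close>

lemma steady_state_exists:
  assumes fin: "finite G" and one: "(1, 0) \<in> G" "(0, 1) \<in> G"
    and Q: "\<forall>p\<in>G. Q p > 0" "Q (1, 0) = 1" "Q (0, 1) = 1"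
    and pos: "\<rho> > 0" "\<sigma> > 0"
  obtains x y where
    "(\<Sum>p\<in>G. real (fst p) * cbar Q (exp x) (exp y) p) = \<rho>"
    "(\<Sum>p\<in>G. real (snd p) * cbar Q (exp x) (exp y) p) = \<sigma>"
proof -
  let ?F = "free_energy Q G \<rho> \<sigma>"
  define C where "C = 2 * \<rho> * \<bar>1 - ln (2 * \<rho>)\<bar> + 2 * \<sigma> * \<bar>1 - ln (2 * \<sigma>)\<bar>"
  define \<kappa> where "\<kappa> = min \<rho> \<sigma>"
  have \<kappa>: "\<kappa> > 0" "\<kappa> \<le> \<rho>" "\<kappa> \<le> \<sigma>" using pos by (auto simp: \<kappa>_def)
  have coercive: "\<kappa> * \<bar>x\<bar> + \<kappa> * \<bar>y\<bar> - C \<le> ?F x y" for x y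
    using exp_add_exp_le_sum_cbar[OF fin one Q, of x y] \<kappa>
      linear_minus_const_le_exp_minus_linear[of \<kappa> \<rho> \<rho> x]
      linear_minus_const_le_exp_minus_linear[of \<kappa> \<sigma> \<sigma> y]
    by (simp add: free_energy_finite fin C_def)
  \<comment> \<open>With this radius \<open>\<kappa> * R\<close> exceeds \<open>?F 0 0 + C\<close>,
    so outside the box the free energy is larger than at the origin and a minimizer over the box is
    a global one.\<close>
  define R where "R = \<bar>?F 0 0 + C\<bar> / \<kappa> + 1"
  have "R > 0" using \<kappa> unfolding R_def by (intro add_nonneg_pos divide_nonneg_pos) auto
  have outside: "?F x y > ?F 0 0" if "R < \<bar>x\<bar> \<or> R < \<bar>y\<bar>" for x y
  proof -
    have "R < \<bar>x\<bar> + \<bar>y\<bar>" using that by auto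
    then have "\<kappa> * R < \<kappa> * (\<bar>x\<bar> + \<bar>y\<bar>)" using \<kappa> by simp
    moreover have "\<kappa> * R = \<bar>?F 0 0 + C\<bar> + \<kappa>" using \<kappa> by (simp add: R_def field_simps)
    ultimately show ?thesis using coercive[of x y] \<kappa> by (simp add: algebra_simps)
  qed
  have cont: "continuous_on ({-R..R} \<times> {-R..R}) (\<lambda>q. ?F (fst q) (snd q))"
    unfolding free_energy_finite[OF fin] cbar_exp by (intro continuous_intros)
  have "\<exists>q\<in>{-R..R} \<times> {-R..R}. \<forall>q'\<in>{-R..R} \<times> {-R..R}. ?F (fst q) (snd q) \<le> ?F (fst q') (snd q')"
    using \<open>R > 0\<close> by (intro continuous_attains_inf cont compact_Times compact_Icc) auto
  then obtain q where
    q: "\<forall>q'\<in>{-R..R} \<times> {-R..R}. ?F (fst q) (snd q) \<le> ?F (fst q') (snd q')" by blast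
  define x y where "x = fst q" and "y = snd q"
  have min_box: "?F x y \<le> ?F x' y'" if "x' \<in> {-R..R}" "y' \<in> {-R..R}" for x' y'
    using bspec[OF q, of "(x', y')"] that by (simp add: x_def y_def)
  have "?F x y \<le> ?F 0 0" using min_box \<open>R > 0\<close> by auto
  then have min: "?F x y \<le> ?F x' y'" for x' y'
    using min_box[of x' y'] outside[of x' y']
    by (cases "R < \<bar>x'\<bar> \<or> R < \<bar>y'\<bar>") (auto simp: abs_le_iff not_less)
  \<comment> \<open>Each partial derivative is a moment minus the prescribed mass, and it vanishes
    at the minimizer.\<close>
  have "((\<lambda>t. ?F t y) has_real_derivative
      (\<Sum>p\<in>G. real (fst p) * cbar Q (exp x) (exp y) p) - \<rho>) (at x)"
    unfolding free_energy_finite[OF fin] cbar_exp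
    by (auto intro!: derivative_eq_intros sum.cong simp: algebra_simps)
  then have "(\<Sum>p\<in>G. real (fst p) * cbar Q (exp x) (exp y) p) - \<rho> = 0"
    by (rule DERIV_local_min[where d = 1]) (auto intro: min)
  moreover have "((\<lambda>t. ?F x t) has_real_derivative
      (\<Sum>p\<in>G. real (snd p) * cbar Q (exp x) (exp y) p) - \<sigma>) (at y)"
    unfolding free_energy_finite[OF fin] cbar_exp
    by (auto intro!: derivative_eq_intros sum.cong simp: algebra_simps)
  then have "(\<Sum>p\<in>G. real (snd p) * cbar Q (exp x) (exp y) p) - \<sigma> = 0"
    by (rule DERIV_local_min[where d = 1]) (auto intro: min)
  ultimately show ?thesis by (intro that) auto
qed

lemma mult_ln_diff_nonneg:
  fixes a b :: real
  assumes "a > 0" "b > 0"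
  shows "(a - b) * (ln a - ln b) \<ge> 0"
  using assms by (cases "a \<le> b") (auto intro: mult_nonneg_nonneg mult_nonpos_nonpos)

lemma mult_ln_diff_pos:
  fixes a b :: real
  assumes "a > 0" "b > 0" "a \<noteq> b"
  shows "(a - b) * (ln a - ln b) > 0"
  using assms by (cases "a < b") (auto intro: mult_pos_pos mult_neg_neg)

text \<open>Strict monotonicity of \<open>ln\<close>: the sum of
  \<open>(c - c') * (ln c - ln c')\<close> over \<open>G\<close> is a linear combination of the
  differences of the moments, hence 0, while each of its terms is positive unless
  \<open>c = c'\<close>. Comparing the monomers then identifies the parameters.\<close>

lemma steady_state_unique:
  assumes fin: "finite G" and one: "(1, 0) \<in> G" "(0, 1) \<in> G"
    and Q: "\<forall>p\<in>G. Q p > 0" "Q (1, 0) = 1" "Q (0, 1) = 1"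
    and pos: "z > 0" "w > 0" "z' > 0" "w' > 0"
    and "(\<Sum>p\<in>G. real (fst p) * cbar Q z w p) = (\<Sum>p\<in>G. real (fst p) * cbar Q z' w' p)"
    and "(\<Sum>p\<in>G. real (snd p) * cbar Q z w p) = (\<Sum>p\<in>G. real (snd p) * cbar Q z' w' p)"
  shows "z = z' \<and> w = w'"
proof -
  let ?t = "\<lambda>p. (cbar Q z w p - cbar Q z' w' p) * (ln (cbar Q z w p) - ln (cbar Q z' w' p))"
  have "sum ?t G = (\<Sum>p\<in>G. (ln z - ln z') * (real (fst p) * cbar Q z w p - real (fst p) * cbar Q z' w' p)
      + (ln w - ln w') * (real (snd p) * cbar Q z w p - real (snd p) * cbar Q z' w' p))"
    using Q pos by (intro sum.cong) (auto simp: ln_cbar algebra_simps)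
  also have "\<dots> = 0"
    using assms by (simp add: sum.distrib sum_subtractf flip: sum_distrib_left)
  finally have "sum ?t G = 0" .
  moreover have "\<forall>p\<in>G. ?t p \<ge> 0"
    using Q pos by (auto intro!: mult_ln_diff_nonneg cbar_pos)
  ultimately have "\<forall>p\<in>G. ?t p = 0"
    using fin by (simp add: sum_nonneg_eq_0_iff)
  then have "cbar Q z w p = cbar Q z' w' p" if "p \<in> G" for p
    using mult_ln_diff_pos[of "cbar Q z w p" "cbar Q z' w' p"] Q pos that cbar_pos by fastforce
  from this[OF one(1)] this[OF one(2)] show ?thesis using Q by (simp add: cbar_def)
qed

text \<open>Resolves the definite description: positive masses force both parameters to be positive,
  so they have logarithms and the uniqueness result applies to every candidate.\<close>

lemma cbar_fin_eq_exp:
  assumes fin: "finite G" and one: "(1, 0) \<in> G" "(0, 1) \<in> G"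
    and Q: "\<forall>p\<in>G. Q p > 0" "Q (1, 0) = 1" "Q (0, 1) = 1"
    and pos: "\<rho> > 0" "\<sigma> > 0"
  obtains x y where "cbar_fin Q G \<rho> \<sigma> = cbar Q (exp x) (exp y)"
    "(\<Sum>p\<in>G. real (fst p) * cbar Q (exp x) (exp y) p) = \<rho>"
    "(\<Sum>p\<in>G. real (snd p) * cbar Q (exp x) (exp y) p) = \<sigma>"
proof -
  obtain x y where xy: "(\<Sum>p\<in>G. real (fst p) * cbar Q (exp x) (exp y) p) = \<rho>"
    "(\<Sum>p\<in>G. real (snd p) * cbar Q (exp x) (exp y) p) = \<sigma>"
    using steady_state_exists[OF assms] by blast
  define P where "P = (\<lambda>(z', w'). z' \<ge> 0 \<and> w' \<ge> 0 \<and>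
            (\<Sum>(r, s)\<in>G. real r * (z' ^ r * w' ^ s * Q (r, s))) = \<rho> \<and>
            (\<Sum>(r, s)\<in>G. real s * (z' ^ r * w' ^ s * Q (r, s))) = \<sigma>)"
  have P_iff: "P (z', w') \<longleftrightarrow> z' \<ge> 0 \<and> w' \<ge> 0 \<and>
      (\<Sum>p\<in>G. real (fst p) * cbar Q z' w' p) = \<rho> \<and>
      (\<Sum>p\<in>G. real (snd p) * cbar Q z' w' p) = \<sigma>" for z' w'
    by (simp add: P_def cbar_def case_prod_beta)
  have "The P = (exp x, exp y)"
  proof (rule the_equality)
    show "P (exp x, exp y)" using xy by (simp add: P_iff)
  next
    fix q assume "P q"
    then obtain z' w' where q: "q = (z', w')" and nn: "z' \<ge> 0" "w' \<ge> 0"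
      and eq: "(\<Sum>p\<in>G. real (fst p) * cbar Q z' w' p) = \<rho>"
        "(\<Sum>p\<in>G. real (snd p) * cbar Q z' w' p) = \<sigma>"
      by (cases q) (auto simp: P_iff)
    \<comment> \<open>The power \<open>0 ^ r\<close> is nonzero only for \<open>r = 0\<close>, and
      there the weight \<open>r\<close> vanishes.\<close>
    have "(\<Sum>p\<in>G. real (fst p) * cbar Q z' w' p) = 0" if "z' = 0"
      using that by (intro sum.neutral) (auto simp: cbar_def)
    moreover have "(\<Sum>p\<in>G. real (snd p) * cbar Q z' w' p) = 0" if "w' = 0"
      using that by (intro sum.neutral) (auto simp: cbar_def)
    ultimately have "z' > 0" "w' > 0" using nn eq pos by (auto simp: less_le)
    then show "q = (exp x, exp y)"
      using steady_state_unique[OF fin one Q, of z' w' "exp x" "exp y"] eq xy q by simp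
  qed
  then have "cbar_fin Q G \<rho> \<sigma> = cbar Q (exp x) (exp y)"
    by (simp add: cbar_fin_def P_def)
  with xy show ?thesis by (intro that)
qed

section \<open>The existence region and the growth of \<open>Q\<close>\<close>

lemma existence_region_iff:
  "(z, w) \<in> existence_region Q \<longleftrightarrow> z \<ge> 0 \<and> w \<ge> 0 \<and>
     (\<lambda>p. real (fst p) * cbar Q z w p) summable_on Omega \<and>
     (\<lambda>p. real (snd p) * cbar Q z w p) summable_on Omega"
  by (simp add: existence_region_def case_prod_unfold)

lemma rho_of_eq: "rho_of c = (\<Sum>\<^sub>\<infinity>p\<in>Omega. real (fst p) * c p)"
  by (simp add: rho_of_def case_prod_unfold)

lemma sigma_of_eq: "sigma_of c = (\<Sum>\<^sub>\<infinity>p\<in>Omega. real (snd p) * c p)"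
  by (simp add: sigma_of_def case_prod_unfold)

lemma finite_degree_le: "finite {p \<in> Omega. fst p + snd p \<le> M}"
  by (rule finite_subset[of _ "{..M} \<times> {..M}"]) auto

text \<open>Every index in \<open>Omega\<close> has degree at least 1, so the sum of the two first
  moments dominates the partition sum.\<close>

lemma summable_on_cbar:
  assumes Q: "\<forall>p\<in>Omega. Q p > 0" and E: "(z, w) \<in> existence_region Q"
  shows "cbar Q z w summable_on Omega"
proof (rule summable_on_comparison_test)
  show "(\<lambda>p. real (fst p) * cbar Q z w p + real (snd p) * cbar Q z w p) summable_on Omega"
    using E by (intro summable_on_add) (simp_all add: existence_region_iff)
  fix p assume p: "p \<in> Omega"
  have nn: "cbar Q z w p \<ge> 0"
    using Q E p by (cases p) (auto simp: existence_region_iff cbar_def less_imp_le)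
  have "1 * cbar Q z w p \<le> (real (fst p) + real (snd p)) * cbar Q z w p"
    using p nn by (intro mult_right_mono) (auto simp: Omega_def)
  with nn show "cbar Q z w p \<le> real (fst p) * cbar Q z w p + real (snd p) * cbar Q z w p"
    and "0 \<le> cbar Q z w p" by (simp_all add: algebra_simps)
qed

text \<open>A positive limit inferior bounds \<open>Q p\<close> below by a fixed power base
  \<open>q\<close> raised to the degree, for all large degrees. The finitely many remaining indices
  are absorbed into \<open>L\<close>, since the degree is at least 1.\<close>

lemma ln_Q_lower_bound:
  assumes Q: "\<forall>p\<in>Omega. Q p > 0"
    and liminf: "lim (\<lambda>N::nat. INF (r, s)\<in>{(r, s)\<in>Omega. r + s \<ge> N}.
                  ereal (Q (r, s) powr (1 / real (r + s)))) > 0"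
  obtains L where "L \<ge> 0" "\<And>p. p \<in> Omega \<Longrightarrow> - ln (Q p) \<le> L * real (fst p + snd p)"
proof -
  define X where "X = (\<lambda>N::nat. INF (r, s)\<in>{(r, s)\<in>Omega. r + s \<ge> N}.
                  ereal (Q (r, s) powr (1 / real (r + s))))"
  \<comment> \<open>The infima run over shrinking sets, so their limit is a supremum and some single
    tail already has a positive infimum.\<close>
  have "incseq X"
    unfolding incseq_def X_def by (auto intro!: INF_superset_mono)
  then have "lim X = (SUP N. X N)" by (intro limI LIMSEQ_SUP)
  with liminf have "0 < (SUP N. X N)" by (simp add: X_def)
  then obtain N where "0 < X N" by (auto simp: less_SUP_iff)
  then obtain q where q: "q > 0" "ereal q < X N" using ereal_dense2 by force
  define S where "S = {p \<in> Omega. fst p + snd p \<le> N}"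
  define L where "L = \<bar>ln q\<bar> + (\<Sum>p\<in>S. \<bar>ln (Q p)\<bar>)"
  have L: "L \<ge> \<bar>ln q\<bar>" unfolding L_def by (simp add: sum_nonneg)
  have "- ln (Q p) \<le> L * real (fst p + snd p)" if p: "p \<in> Omega" for p
  proof (cases "fst p + snd p \<le> N")
    case True
    then have "\<bar>ln (Q p)\<bar> \<le> (\<Sum>p\<in>S. \<bar>ln (Q p)\<bar>)"
      using p by (intro member_le_sum) (auto simp: S_def finite_degree_le)
    then have "- ln (Q p) \<le> L" unfolding L_def by linarith
    also have "\<dots> = L * 1" by simp
    also have "\<dots> \<le> L * real (fst p + snd p)"
      using L p by (intro mult_left_mono) (auto simp: Omega_def)
    finally show ?thesis .
  next
    case False
    obtain r s where rs: "p = (r, s)" by force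
    have n: "real (r + s) > 0" using p rs by (simp add: Omega_def)
    have "ereal q < ereal (Q (r, s) powr (1 / real (r + s)))"
      using less_INF_D[OF q(2)[unfolded X_def], of "(r, s)"] p rs False by simp
    then have "ln q < ln (Q (r, s) powr (1 / real (r + s)))"
      using q(1) by (metis less_ereal.simps(1) ln_less_cancel_iff less_trans)
    also have "\<dots> = ln (Q (r, s)) / real (r + s)"
      using Q p rs by auto
    finally have "- ln (Q p) < - ln q * real (r + s)"
      using n rs by (simp add: field_simps del: of_nat_add)
    also have "\<dots> \<le> L * real (r + s)"
      using L by (intro mult_right_mono) auto
    finally show ?thesis using rs by simp
  qed
  moreover have "L \<ge> 0" using L by linarith
  ultimately show ?thesis by (intro that)
qed

text \<open>The shift multiplies the term of degree \<open>n\<close> by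
  \<open>exp (- \<eta> * n)\<close>, and \<open>n * exp (- \<eta> * n) \<le> 1 / \<eta>\<close>.
  Hence the first moments after the shift are dominated by the partition sum before it.\<close>

lemma exp_shift_in_existence_region:
  assumes Q: "\<forall>p\<in>Omega. Q p > 0"
    and summ: "cbar Q (exp x) (exp y) summable_on Omega" and "\<eta> > 0"
  shows "(exp (x - \<eta>), exp (y - \<eta>)) \<in> existence_region Q"
proof -
  define c where "c = cbar Q (exp x) (exp y)"
  define d where "d = cbar Q (exp (x - \<eta>)) (exp (y - \<eta>))"
  have d: "d p = exp (- \<eta> * real (fst p + snd p)) * c p" for p
    unfolding c_def d_def cbar_exp by (simp add: exp_add[symmetric] algebra_simps)
  have c_nn: "c p \<ge> 0" if "p \<in> Omega" for p
    using Q that by (auto simp: c_def intro!: less_imp_le cbar_pos)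
  have bound: "real k * d p \<le> c p * (1 / \<eta>)" if "p \<in> Omega" "k \<le> fst p + snd p" for k p
  proof -
    define n where "n = real (fst p + snd p)"
    have "\<eta> * n \<le> exp (\<eta> * n)" using exp_ge_add_one_self[of "\<eta> * n"] by linarith
    then have "n * exp (- (\<eta> * n)) \<le> 1 / \<eta>"
      using \<open>\<eta> > 0\<close> by (simp add: exp_minus field_simps)
    moreover have "real k * exp (- (\<eta> * n)) \<le> n * exp (- (\<eta> * n))"
      using that by (intro mult_right_mono) (auto simp: n_def)
    ultimately have "real k * exp (- (\<eta> * n)) \<le> 1 / \<eta>" by linarith
    then have "real k * exp (- (\<eta> * n)) * c p \<le> 1 / \<eta> * c p"
      using c_nn that by (intro mult_right_mono) auto
    then show ?thesis by (simp add: d n_def mult_ac)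
  qed
  have d_nn: "d p \<ge> 0" if "p \<in> Omega" for p
    using c_nn[OF that] by (simp add: d)
  have summ': "(\<lambda>p. c p * (1 / \<eta>)) summable_on Omega"
    using summ unfolding c_def by (rule summable_on_cmult_left)
  have "(\<lambda>p. real (fst p) * d p) summable_on Omega"
    by (rule summable_on_comparison_test[OF summ'])
      (use bound d_nn in \<open>auto intro!: mult_nonneg_nonneg\<close>)
  moreover have "(\<lambda>p. real (snd p) * d p) summable_on Omega"
    by (rule summable_on_comparison_test[OF summ'])
      (use bound d_nn in \<open>auto intro!: mult_nonneg_nonneg\<close>)
  ultimately show ?thesis by (simp add: existence_region_iff d_def)
qed

section \<open>The variational inequality as minimality of the free energy\<close>

context
  fixes Q :: "nat \<times> nat \<Rightarrow> real" and \<rho> \<sigma> z w :: real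
  assumes Q: "\<forall>p\<in>Omega. Q p > 0"
    and pos: "\<rho> > 0" "\<sigma> > 0" "z > 0" "w > 0"
    and E: "(z, w) \<in> existence_region Q"
    and opt: "\<forall>u v. u > 0 \<and> v > 0 \<and> (u, v) \<in> existence_region Q \<longrightarrow>
                   ln (z / u) * (\<rho> - rho_of (cbar Q z w))
                 + ln (w / v) * (\<sigma> - sigma_of (cbar Q z w)) \<ge> 0"
begin

text \<open>Convexity: \<open>exp t \<ge> 1 + t\<close>, applied term by term, bounds the free
  energy at \<open>(x, y)\<close> below by its linearization at \<open>(ln z, ln w)\<close>. The
  variational inequality with \<open>u = exp x\<close>, \<open>v = exp y\<close> says that the
  linear part is nonnegative.\<close>

lemma free_energy_minimal_existence_region:
  assumes "(exp x, exp y) \<in> existence_region Q"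
  shows "free_energy Q Omega \<rho> \<sigma> (ln z) (ln w) \<le> free_energy Q Omega \<rho> \<sigma> x y"
proof -
  define c where "c = cbar Q z w"
  define d where "d = cbar Q (exp x) (exp y)"
  define \<xi> \<upsilon> where "\<xi> = x - ln z" and "\<upsilon> = y - ln w"
  have summ_c: "c summable_on Omega" and summ_d: "d summable_on Omega"
    unfolding c_def d_def using Q E assms by (auto intro: summable_on_cbar)
  have c1: "(\<lambda>p. real (fst p) * c p) summable_on Omega"
    and c2: "(\<lambda>p. real (snd p) * c p) summable_on Omega"
    using E by (simp_all add: existence_region_iff c_def)
  have le: "c p + \<xi> * (real (fst p) * c p) + \<upsilon> * (real (snd p) * c p) \<le> d p" if "p \<in> Omega" for p
  proof -
    have c_pos: "c p > 0" using Q pos that by (auto simp: c_def intro: cbar_pos)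
    define t where "t = real (fst p) * \<xi> + real (snd p) * \<upsilon>"
    have "d p = c p * exp t"
    proof -
      have "cbar Q (exp (ln z)) (exp (ln w)) p * exp t = cbar Q (exp x) (exp y) p"
        unfolding cbar_exp t_def \<xi>_def \<upsilon>_def by (simp add: exp_add[symmetric] algebra_simps)
      then show ?thesis using pos by (simp add: c_def d_def)
    qed
    moreover have "c p * (1 + t) \<le> c p * exp t"
      using c_pos by (intro mult_left_mono) auto
    ultimately show ?thesis by (simp add: t_def algebra_simps)
  qed
  have "(\<Sum>\<^sub>\<infinity>p\<in>Omega. c p + \<xi> * (real (fst p) * c p) + \<upsilon> * (real (snd p) * c p)) \<le> infsum d Omega"
    by (intro infsum_mono summable_on_add summable_on_cmult_right summ_c summ_d c1 c2 le)
  also have "(\<Sum>\<^sub>\<infinity>p\<in>Omega. c p + \<xi> * (real (fst p) * c p) + \<upsilon> * (real (snd p) * c p))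
      = infsum c Omega + \<xi> * rho_of c + \<upsilon> * sigma_of c"
    using summ_c c1 c2 by (simp add: infsum_add infsum_cmult_right summable_on_add
      summable_on_cmult_right rho_of_eq sigma_of_eq)
  finally have "infsum c Omega + \<xi> * rho_of c + \<upsilon> * sigma_of c \<le> infsum d Omega" .
  moreover have "- \<xi> * (\<rho> - rho_of c) + - \<upsilon> * (\<sigma> - sigma_of c) \<ge> 0"
    using opt[rule_format, of "exp x" "exp y"] assms pos by (simp add: c_def \<xi>_def \<upsilon>_def ln_div)
  ultimately show ?thesis
    using pos by (simp add: free_energy_def c_def[symmetric] d_def[symmetric] \<xi>_def \<upsilon>_def algebra_simps)
qed

text \<open>A point where the partition sum converges but its first moments do not is approximated by
  points of the existence region along the diagonal.\<close>

lemma free_energy_minimal: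
  assumes summ: "cbar Q (exp x) (exp y) summable_on Omega"
  shows "free_energy Q Omega \<rho> \<sigma> (ln z) (ln w) \<le> free_energy Q Omega \<rho> \<sigma> x y"
proof (rule field_le_epsilon)
  fix e :: real assume "e > 0"
  \<comment> \<open>The shift only decreases the partition sum, and it raises the linear part by
    \<open>\<eta> * (\<rho> + \<sigma>)\<close>, which this choice makes equal to
    \<open>e\<close>.\<close>
  define \<eta> where "\<eta> = e / (\<rho> + \<sigma>)"
  have "\<eta> > 0" using \<open>e > 0\<close> pos by (simp add: \<eta>_def)
  have E': "(exp (x - \<eta>), exp (y - \<eta>)) \<in> existence_region Q"
    using Q summ \<open>\<eta> > 0\<close> by (rule exp_shift_in_existence_region)
  have "infsum (cbar Q (exp (x - \<eta>)) (exp (y - \<eta>))) Omega \<le> infsum (cbar Q (exp x) (exp y)) Omega"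
  proof (rule infsum_mono)
    show "cbar Q (exp (x - \<eta>)) (exp (y - \<eta>)) summable_on Omega"
      using Q E' by (rule summable_on_cbar)
    show "cbar Q (exp (x - \<eta>)) (exp (y - \<eta>)) p \<le> cbar Q (exp x) (exp y) p" if "p \<in> Omega" for p
    proof -
      have "real (fst p) * (x - \<eta>) + real (snd p) * (y - \<eta>) \<le> real (fst p) * x + real (snd p) * y"
        using \<open>\<eta> > 0\<close> by (intro add_mono mult_left_mono) auto
      then show ?thesis
        unfolding cbar_exp using Q that by (intro mult_right_mono) (auto simp: less_imp_le)
    qed
  qed (rule summ)
  then have "free_energy Q Omega \<rho> \<sigma> (x - \<eta>) (y - \<eta>) \<le> free_energy Q Omega \<rho> \<sigma> x y + \<eta> * (\<rho> + \<sigma>)"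
    by (simp add: free_energy_def algebra_simps)
  also have "\<eta> * (\<rho> + \<sigma>) = e" using pos by (simp add: \<eta>_def)
  finally show "free_energy Q Omega \<rho> \<sigma> (ln z) (ln w) \<le> free_energy Q Omega \<rho> \<sigma> x y + e"
    using free_energy_minimal_existence_region[OF E'] by linarith
qed

text \<open>Otherwise there are points of free energy below \<open>B\<close> for truncation degrees
  tending to infinity and masses tending to \<open>\<rho>\<close> and \<open>\<sigma>\<close>.
  Coercivity keeps these points bounded; at a limit point the full free energy is at most
  \<open>B\<close>, which contradicts minimality.\<close>

lemma free_energy_truncated_ge:
  assumes Q1: "Q (1, 0) = 1" "Q (0, 1) = 1" and "\<epsilon> > 0"
  shows "\<exists>n. \<forall>M \<rho>' \<sigma>' x y. n \<le> M \<and> \<rho> - 1 / real (Suc n) \<le> \<rho>' \<and> \<rho>' \<le> \<rho> \<and>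
      \<sigma> - 1 / real (Suc n) \<le> \<sigma>' \<and> \<sigma>' \<le> \<sigma> \<longrightarrow>
      free_energy Q Omega \<rho> \<sigma> (ln z) (ln w) - \<epsilon>
      \<le> free_energy Q {p \<in> Omega. fst p + snd p \<le> M} \<rho>' \<sigma>' x y"
proof (rule ccontr)
  define B where "B = free_energy Q Omega \<rho> \<sigma> (ln z) (ln w) - \<epsilon>"
  define G where "G = (\<lambda>M. {p \<in> Omega. fst p + snd p \<le> M})"
  have fin: "finite (G M)" for M by (simp add: G_def finite_degree_le)
  assume "\<not> ?thesis"
  then have "\<forall>n. \<exists>M \<rho>' \<sigma>' x y. n \<le> M \<and> \<rho> - 1 / real (Suc n) \<le> \<rho>' \<and> \<rho>' \<le> \<rho> \<and>
      \<sigma> - 1 / real (Suc n) \<le> \<sigma>' \<and> \<sigma>' \<le> \<sigma> \<and> free_energy Q (G M) \<rho>' \<sigma>' x y < B"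
    unfolding B_def G_def by (auto simp: not_le)
  then obtain M R S X Y where M: "\<And>n. n \<le> M n"
    and R: "\<And>n. \<rho> - 1 / real (Suc n) \<le> R n" "\<And>n. R n \<le> \<rho>"
    and S: "\<And>n. \<sigma> - 1 / real (Suc n) \<le> S n" "\<And>n. S n \<le> \<sigma>"
    and less: "\<And>n. free_energy Q (G (M n)) (R n) (S n) (X n) (Y n) < B"
    by metis
  have inv0: "(\<lambda>n. 1 / real (Suc n)) \<longlonglongrightarrow> 0"
    using LIMSEQ_inverse_real_of_nat by (simp add: inverse_eq_divide)
  have R_lim: "R \<longlonglongrightarrow> \<rho>"
    by (rule tendsto_sandwich[where f = "\<lambda>n. \<rho> - 1 / real (Suc n)" and h = "\<lambda>n. \<rho>"])
      (use R tendsto_diff[OF tendsto_const inv0] in \<open>auto simp del: of_nat_Suc\<close>)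
  have S_lim: "S \<longlonglongrightarrow> \<sigma>"
    by (rule tendsto_sandwich[where f = "\<lambda>n. \<sigma> - 1 / real (Suc n)" and h = "\<lambda>n. \<sigma>"])
      (use S tendsto_diff[OF tendsto_const inv0] in \<open>auto simp del: of_nat_Suc\<close>)
  \<comment> \<open>Masses of at least half the limit, and at most the limit, make the coercivity
    constants independent of \<open>n\<close>.\<close>
  have "eventually (\<lambda>n. \<rho> / 2 < R n \<and> \<sigma> / 2 < S n) sequentially"
    using pos by (intro eventually_conj order_tendstoD(1)[OF R_lim] order_tendstoD(1)[OF S_lim]) auto
  then obtain k where k: "\<And>n. n \<ge> k \<Longrightarrow> \<rho> / 2 < R n \<and> \<sigma> / 2 < S n"
    by (auto simp: eventually_sequentially)
  define C where "C = 2 * \<rho> * \<bar>1 - ln (2 * \<rho>)\<bar> + 2 * \<sigma> * \<bar>1 - ln (2 * \<sigma>)\<bar>"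
  \<comment> \<open>The offset \<open>Suc k\<close> ensures both the mass bounds and
    \<open>M n \<ge> 1\<close>, so that the truncations contain the monomers.\<close>
  define f where "f = (\<lambda>n. (X (n + Suc k), Y (n + Suc k)))"
  have bound: "\<rho> / 2 * \<bar>X n\<bar> + \<sigma> / 2 * \<bar>Y n\<bar> < B + C" if "n \<ge> Suc k" for n
  proof -
    have "M n \<ge> 1" using M[of n] that by simp
    then have "exp (X n) + exp (Y n) \<le> sum (cbar Q (exp (X n)) (exp (Y n))) (G (M n))"
      using Q Q1 by (intro exp_add_exp_le_sum_cbar fin) (auto simp: G_def Omega_def)
    moreover have "\<rho> / 2 * \<bar>X n\<bar> - 2 * \<rho> * \<bar>1 - ln (2 * \<rho>)\<bar> \<le> exp (X n) - R n * X n"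
      "\<sigma> / 2 * \<bar>Y n\<bar> - 2 * \<sigma> * \<bar>1 - ln (2 * \<sigma>)\<bar> \<le> exp (Y n) - S n * Y n"
      using k[of n] that pos R(2)[of n] S(2)[of n]
      by (intro linear_minus_const_le_exp_minus_linear; simp)+
    ultimately show ?thesis using less[of n] by (simp add: free_energy_finite fin C_def)
  qed
  have "norm (f n) \<le> (B + C) / (\<rho> / 2) + (B + C) / (\<sigma> / 2)" for n
  proof -
    have nn: "\<rho> / 2 * \<bar>X (n + Suc k)\<bar> \<ge> 0" "\<sigma> / 2 * \<bar>Y (n + Suc k)\<bar> \<ge> 0" using pos by auto
    have "\<bar>X (n + Suc k)\<bar> \<le> (B + C) / (\<rho> / 2)"
    proof -
      have "\<rho> / 2 * \<bar>X (n + Suc k)\<bar> \<le> B + C" using bound[of "n + Suc k"] nn by linarith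
      then show ?thesis using pos by (simp add: field_simps)
    qed
    moreover have "\<bar>Y (n + Suc k)\<bar> \<le> (B + C) / (\<sigma> / 2)"
    proof -
      have "\<sigma> / 2 * \<bar>Y (n + Suc k)\<bar> \<le> B + C" using bound[of "n + Suc k"] nn by linarith
      then show ?thesis using pos by (simp add: field_simps)
    qed
    ultimately show ?thesis
      using norm_Pair_le[of "X (n + Suc k)" "Y (n + Suc k)"] by (simp add: f_def)
  qed
  then have "bounded (range f)" by (auto simp: bounded_iff)
  then obtain l \<phi> where \<phi>: "strict_mono (\<phi> :: nat \<Rightarrow> nat)" and lim: "(f \<circ> \<phi>) \<longlonglongrightarrow> l"
    using bounded_imp_convergent_subsequence by blast
  define \<psi> where "\<psi> = (\<lambda>n. \<phi> n + Suc k)"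
  have \<psi>: "strict_mono \<psi>" using \<phi> by (auto simp: \<psi>_def strict_mono_def)
  define x y where "x = fst l" and "y = snd l"
  have X_lim: "(\<lambda>n. X (\<psi> n)) \<longlonglongrightarrow> x" and Y_lim: "(\<lambda>n. Y (\<psi> n)) \<longlonglongrightarrow> y"
    using tendsto_fst[OF lim] tendsto_snd[OF lim] by (simp_all add: f_def \<psi>_def x_def y_def o_def)
  have R_lim': "(\<lambda>n. R (\<psi> n)) \<longlonglongrightarrow> \<rho>" and S_lim': "(\<lambda>n. S (\<psi> n)) \<longlonglongrightarrow> \<sigma>"
    using LIMSEQ_subseq_LIMSEQ[OF R_lim \<psi>] LIMSEQ_subseq_LIMSEQ[OF S_lim \<psi>] by (simp_all add: o_def)
  \<comment> \<open>A Fatou argument: a fixed finite \<open>F\<close> is eventually contained in the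
    truncations, so its partial sum inherits the bound in the limit. This gives summability at the
    limit point as well as the bound on the full sum.\<close>
  have finite_le: "sum (cbar Q (exp x) (exp y)) F \<le> B + \<rho> * x + \<sigma> * y"
    if F: "finite F" "F \<subseteq> Omega" for F
  proof (rule LIMSEQ_le)
    show "(\<lambda>n. sum (cbar Q (exp (X (\<psi> n))) (exp (Y (\<psi> n)))) F) \<longlonglongrightarrow> sum (cbar Q (exp x) (exp y)) F"
      unfolding cbar_exp by (intro tendsto_intros X_lim Y_lim)
    show "(\<lambda>n. B + R (\<psi> n) * X (\<psi> n) + S (\<psi> n) * Y (\<psi> n)) \<longlonglongrightarrow> B + \<rho> * x + \<sigma> * y"
      by (intro tendsto_intros X_lim Y_lim R_lim' S_lim')
    define K where "K = (\<Sum>p\<in>F. fst p + snd p)"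
    have "sum (cbar Q (exp (X (\<psi> n))) (exp (Y (\<psi> n)))) F
        \<le> B + R (\<psi> n) * X (\<psi> n) + S (\<psi> n) * Y (\<psi> n)" if "n \<ge> K" for n
    proof -
      have "K \<le> M (\<psi> n)"
        using that seq_suble[OF \<psi>, of n] M[of "\<psi> n"] by linarith
      moreover have "fst p + snd p \<le> K" if "p \<in> F" for p
        unfolding K_def using F that member_le_sum[of p F "\<lambda>p. fst p + snd p"] by simp
      ultimately have "F \<subseteq> G (M (\<psi> n))" using F by (auto simp: G_def intro: order_trans)
      then have "sum (cbar Q (exp (X (\<psi> n))) (exp (Y (\<psi> n)))) F
          \<le> sum (cbar Q (exp (X (\<psi> n))) (exp (Y (\<psi> n)))) (G (M (\<psi> n)))"
        using Q by (intro sum_mono2 fin) (auto intro!: less_imp_le cbar_pos simp: G_def)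
      then show ?thesis using less[of "\<psi> n"] by (simp add: free_energy_finite fin)
    qed
    then show "\<exists>N. \<forall>n\<ge>N. sum (cbar Q (exp (X (\<psi> n))) (exp (Y (\<psi> n)))) F
        \<le> B + R (\<psi> n) * X (\<psi> n) + S (\<psi> n) * Y (\<psi> n)" by blast
  qed
  have summ: "cbar Q (exp x) (exp y) summable_on Omega"
  proof (rule nonneg_bdd_above_summable_on)
    show "cbar Q (exp x) (exp y) p \<ge> 0" if "p \<in> Omega" for p
      using Q that by (intro less_imp_le cbar_pos) auto
    show "bdd_above (sum (cbar Q (exp x) (exp y)) ` {F. F \<subseteq> Omega \<and> finite F})"
      by (rule bdd_aboveI2) (use finite_le in blast)
  qed
  have "infsum (cbar Q (exp x) (exp y)) Omega \<le> B + \<rho> * x + \<sigma> * y"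
    by (intro infsum_le_finite_sums summ finite_le)
  then have "free_energy Q Omega \<rho> \<sigma> x y \<le> B" by (simp add: free_energy_def)
  with free_energy_minimal[OF summ] \<open>\<epsilon> > 0\<close> show False by (simp add: B_def)
qed

end

section \<open>Entropy identities and the entropy outside a finite set\<close>

text \<open>The terms \<open>c * ln c\<close> and \<open>c * ln (Q p)\<close> cancel between the two
  entropies, so only moments and partition sums remain.\<close>

lemma H_fin_cbar_diff:
  assumes "\<forall>p\<in>G. Q p > 0" "\<forall>p\<in>G. c p \<ge> 0" "a > 0" "b > 0" "z > 0" "w > 0"
  shows "H_fin G c (cbar Q a b) - H_fin G c (cbar Q z w)
    = (\<Sum>p\<in>G. real (fst p) * c p) * (ln z - ln a) + (\<Sum>p\<in>G. real (snd p) * c p) * (ln w - ln b)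
      + sum (cbar Q a b) G - sum (cbar Q z w) G"
  unfolding H_fin_def sum_subtractf[symmetric] sum.distrib[symmetric] sum_distrib_right
  using assms by (intro sum.cong) (auto simp: mult_Psi_divide cbar_pos ln_cbar algebra_simps)

lemma H_fin_self:
  assumes "\<forall>p\<in>G. e p > 0"
  shows "H_fin G e e = 0"
  using assms by (auto simp: H_fin_def Psi_def intro!: sum.neutral)

text \<open>Outside \<open>G\<close> the bound \<open>c p \<le> 1\<close> gives
  \<open>c p * ln (c p) \<le> 0\<close>, so the entropy density is at most
  \<open>cbar Q z w p + h p\<close>. This summable majorant also makes the entropy finite.\<close>

lemma H_le_H_fin_add:
  assumes Q: "\<forall>p\<in>Omega. Q p > 0" and E: "(z, w) \<in> existence_region Q" and pos: "z > 0" "w > 0"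
    and c: "\<forall>p\<in>Omega. c p \<ge> 0" and G: "finite G" "G \<subseteq> Omega"
    and c1: "\<And>p. p \<in> Omega - G \<Longrightarrow> c p \<le> 1"
    and h: "\<And>p. p \<in> Omega - G \<Longrightarrow> - c p * ln (cbar Q z w p) \<le> h p"
    and summ_h: "h summable_on (Omega - G)"
  shows "H c (cbar Q z w) \<le> ereal (H_fin G c (cbar Q z w)
    + (\<Sum>\<^sub>\<infinity>p\<in>Omega - G. cbar Q z w p) + (\<Sum>\<^sub>\<infinity>p\<in>Omega - G. h p))"
proof -
  define e where "e = cbar Q z w"
  define f where "f = (\<lambda>p. e p * Psi (c p / e p))"
  have e: "e p > 0" if "p \<in> Omega" for p
    using Q pos that by (auto simp: e_def intro: cbar_pos)
  have f_nn: "f p \<ge> 0" if "p \<in> Omega" for p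
    unfolding f_def using e[OF that] c that by (intro mult_nonneg_nonneg Psi_nonneg) auto
  have summ_e: "e summable_on (Omega - G)"
    using summable_on_cbar[OF Q E] unfolding e_def by (rule summable_on_subset_banach) auto
  have f_le: "f p \<le> e p + h p" if p: "p \<in> Omega - G" for p
  proof -
    have "c p * ln (c p) \<le> 0"
      using c p c1[OF p] by (cases "c p = 0") (auto intro!: mult_nonneg_nonpos)
    then show ?thesis
      using h[OF p] c e p by (auto simp: f_def mult_Psi_divide algebra_simps e_def[symmetric])
  qed
  have summ_f: "f summable_on (Omega - G)"
    by (rule summable_on_comparison_test[OF summable_on_add[OF summ_e summ_h]]) (use f_le f_nn in auto)
  have split: "G \<union> (Omega - G) = Omega" using G by auto
  have "f summable_on (G \<union> (Omega - G))"
    by (intro summable_on_Un_disjoint summ_f) (use G in auto)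
  then have summ_f': "f summable_on Omega" by (simp only: split)
  have "infsum f Omega = sum f G + infsum f (Omega - G)"
    using infsum_Un_disjoint[of f G "Omega - G"] summ_f G by (simp add: Un_absorb1)
  also have "infsum f (Omega - G) \<le> (\<Sum>\<^sub>\<infinity>p\<in>Omega - G. e p + h p)"
    by (intro infsum_mono summ_f summable_on_add summ_e summ_h f_le)
  also have "\<dots> = infsum e (Omega - G) + infsum h (Omega - G)"
    by (intro infsum_add summ_e summ_h)
  finally have "infsum f Omega \<le> sum f G + infsum e (Omega - G) + infsum h (Omega - G)"
    by simp
  \<comment> \<open>Since the real series converges, the sum in the extended reals is its
    image.\<close>
  moreover have "infsum (ereal \<circ> f) Omega = ereal (infsum f Omega)"
    using summ_f' by (intro infsum_comm_additive_general) auto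
  ultimately show ?thesis by (simp add: H_def H_fin_def f_def e_def o_def)
qed

lemma infsum_degree_split:
  fixes g :: "nat \<times> nat \<Rightarrow> real"
  assumes "g summable_on Omega"
  shows "infsum g Omega = sum g {p \<in> Omega. fst p + snd p \<le> K}
    + infsum g {p \<in> Omega. K < fst p + snd p}"
proof -
  have "infsum g ({p \<in> Omega. fst p + snd p \<le> K} \<union> {p \<in> Omega. K < fst p + snd p})
      = infsum g {p \<in> Omega. fst p + snd p \<le> K} + infsum g {p \<in> Omega. K < fst p + snd p}"
    using assms by (intro infsum_Un_disjoint summable_on_subset_banach[OF assms]) auto
  moreover have "{p \<in> Omega. fst p + snd p \<le> K} \<union> {p \<in> Omega. K < fst p + snd p} = Omega" by auto
  ultimately show ?thesis by (simp add: finite_degree_le)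
qed

section \<open>The entropy inequality on \<open>\<Gamma>\<close>\<close>

theorem lemma4p7:
  fixes Q :: "nat \<times> nat \<Rightarrow> real" and \<rho> \<sigma> z w :: real
  assumes Q_pos: "\<forall>p\<in>Omega. Q p > 0"
    and Q_10: "Q (1, 0) = 1" and Q_01: "Q (0, 1) = 1"
    and "\<rho> > 0" and "\<sigma> > 0"
    and Q_inf: "lim (\<lambda>N::nat. INF (r, s)\<in>{(r, s)\<in>Omega. r + s \<ge> N}.
                  ereal (Q (r, s) powr (1 / real (r + s)))) > 0"
    and Q_sup: "lim (\<lambda>N::nat. SUP (r, s)\<in>{(r, s)\<in>Omega. r + s \<ge> N}.
                  ereal (Q (r, s) powr (1 / real (r + s)))) < \<infinity>"
    and zw_E: "(z, w) \<in> existence_region Q" and "z > 0" and "w > 0"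
    and zw_opt: "\<forall>u v. u > 0 \<and> v > 0 \<and> (u, v) \<in> existence_region Q \<longrightarrow>
                   ln (z / u) * (\<rho> - rho_of (cbar Q z w))
                 + ln (w / v) * (\<sigma> - sigma_of (cbar Q z w)) \<ge> 0"
  shows "\<forall>\<epsilon>>0. \<exists>(M::nat) \<delta>1 \<delta>2. M \<ge> 1 \<and> \<delta>1 > 0 \<and> \<delta>2 > 0 \<and>
    (\<forall>(N::nat) c. N \<ge> 1 \<and> c \<in> X_plus_at \<rho> \<sigma> \<and> c (1, 0) > 0 \<and> c (0, 1) > 0 \<and>
        (\<Sum>\<^sub>\<infinity>(r, s)\<in>{(r, s)\<in>Omega. r + s \<ge> N + 1}. real (r + s) * c (r, s)) \<le> \<delta>2 \<longrightarrow>
      (let b = cbar Q (c (1, 0)) (c (0, 1));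
           \<Gamma> = Gamma_set b M N \<delta>1
       in ereal (H_fin \<Gamma> c b) \<ge>
            H c (cbar Q z w)
          + ereal (H_fin \<Gamma> (cbar_fin Q \<Gamma> (rho_upto N c) (sigma_upto N c)) b)
          - ereal \<epsilon>))"
proof (intro allI impI)
  fix \<epsilon> :: real assume "\<epsilon> > 0"
  define T where "T = (\<lambda>K. {p \<in> Omega. fst p + snd p \<le> K})"
  define U where "U = (\<lambda>K. {p \<in> Omega. K < fst p + snd p})"
  define x y where "x = ln z" and "y = ln w"
  obtain L0 where "L0 \<ge> 0" and L0: "\<And>p. p \<in> Omega \<Longrightarrow> - ln (Q p) \<le> L0 * real (fst p + snd p)"
    using ln_Q_lower_bound[OF Q_pos Q_inf] by blast
  \<comment> \<open>Chosen so that \<open>- ln (cbar Q z w p)\<close> is at most \<open>L\<close>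
    times the degree of \<open>p\<close>.\<close>
  define L where "L = L0 + \<bar>x\<bar> + \<bar>y\<bar>"
  have "L \<ge> 0" using \<open>L0 \<ge> 0\<close> by (simp add: L_def)
  define F where "F = free_energy Q Omega \<rho> \<sigma> x y"
  obtain n where n: "\<And>M \<rho>' \<sigma>' x' y'. n \<le> M \<Longrightarrow> \<rho> - 1 / real (Suc n) \<le> \<rho>' \<Longrightarrow> \<rho>' \<le> \<rho> \<Longrightarrow>
      \<sigma> - 1 / real (Suc n) \<le> \<sigma>' \<Longrightarrow> \<sigma>' \<le> \<sigma> \<Longrightarrow>
      F - \<epsilon> / 2 \<le> free_energy Q (T M) \<rho>' \<sigma>' x' y'"
    using free_energy_truncated_ge[OF Q_pos \<open>\<rho> > 0\<close> \<open>\<sigma> > 0\<close> \<open>z > 0\<close> \<open>w > 0\<close> zw_E zw_opt Q_10 Q_01,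
        of "\<epsilon> / 2"] \<open>\<epsilon> > 0\<close>
    unfolding F_def T_def x_def y_def by (smt (verit) half_gt_zero)
  \<comment> \<open>Three demands: \<open>n \<le> M\<close> for the truncated free energy,
    \<open>1 \<le> M\<close> to have the monomers in \<open>\<Gamma>\<close>, and
    \<open>\<rho> + \<sigma> \<le> M\<close> so that the mass constraint forces
    \<open>c p \<le> 1\<close> beyond degree \<open>M\<close>.\<close>
  define M where "M = max (max n 1) (nat \<lceil>\<rho> + \<sigma>\<rceil>)"
  have M: "n \<le> M" "1 \<le> M" "\<rho> + \<sigma> \<le> real M" by (auto simp: M_def) linarith
  \<comment> \<open>Collects the coefficients of all errors of order
    \<open>\<delta>\<^sub>2\<close>. The allowance \<open>\<epsilon>\<close> is split into
    \<open>\<epsilon> / 2\<close> for the truncated free energy, \<open>\<epsilon> / 4\<close> for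
    \<open>\<delta>\<^sub>1\<close> and \<open>\<epsilon> / 4\<close> for
    \<open>D * \<delta>\<^sub>2\<close>.\<close>
  define D where "D = L + \<bar>x\<bar> + \<bar>y\<bar> + \<bar>x - ln \<rho>\<bar> + \<bar>y - ln \<sigma>\<bar>"
  have "D \<ge> 0" using \<open>L \<ge> 0\<close> by (simp add: D_def)
  define \<delta>\<^sub>1 where "\<delta>\<^sub>1 = \<epsilon> / 4 / (\<rho> + \<sigma>)"
  define \<delta>\<^sub>2 where "\<delta>\<^sub>2 = min (1 / real (Suc n)) (\<epsilon> / (4 * (D + 1)))"
  have "\<delta>\<^sub>1 > 0" using \<open>\<epsilon> > 0\<close> \<open>\<rho> > 0\<close> \<open>\<sigma> > 0\<close> by (simp add: \<delta>\<^sub>1_def)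
  have "\<delta>\<^sub>2 > 0" using \<open>\<epsilon> > 0\<close> \<open>D \<ge> 0\<close> by (simp add: \<delta>\<^sub>2_def)
  have \<delta>\<^sub>1_eq: "\<delta>\<^sub>1 * (\<rho> + \<sigma>) = \<epsilon> / 4"
  proof -
    have "\<rho> + \<sigma> \<noteq> 0" using \<open>\<rho> > 0\<close> \<open>\<sigma> > 0\<close> by simp
    then show ?thesis by (rule iffD1[OF nonzero_eq_divide_eq, OF _ \<delta>\<^sub>1_def])
  qed
  have \<delta>\<^sub>2_le: "D * \<delta>\<^sub>2 \<le> \<epsilon> / 4" "\<delta>\<^sub>2 \<le> 1 / real (Suc n)"
  proof -
    have "D * \<delta>\<^sub>2 \<le> (D + 1) * \<delta>\<^sub>2" using \<open>\<delta>\<^sub>2 > 0\<close> by (simp add: algebra_simps)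
    also have "\<dots> \<le> (D + 1) * (\<epsilon> / (4 * (D + 1)))"
      using \<open>D \<ge> 0\<close> by (intro mult_left_mono) (auto simp: \<delta>\<^sub>2_def)
    also have "\<dots> = \<epsilon> / 4" using \<open>D \<ge> 0\<close> by (simp add: field_simps)
    finally show "D * \<delta>\<^sub>2 \<le> \<epsilon> / 4" .
  qed (simp add: \<delta>\<^sub>2_def)
  have main: "H c (cbar Q z w) + ereal (H_fin G (cbar_fin Q G (rho_upto N c) (sigma_upto N c)) b)
      - ereal \<epsilon> \<le> ereal (H_fin G c b)"
    if c: "c \<in> X_plus_at \<rho> \<sigma>" "c (1, 0) > 0" "c (0, 1) > 0" and "N \<ge> 1"
      and small: "(\<Sum>\<^sub>\<infinity>p\<in>U N. real (fst p + snd p) * c p) \<le> \<delta>\<^sub>2"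
      and b: "b = cbar Q (c (1, 0)) (c (0, 1))" and G: "G = Gamma_set b M N \<delta>\<^sub>1"
    for N c b G
  proof -
    define \<alpha> \<beta> where "\<alpha> = ln (c (1, 0))" and "\<beta> = ln (c (0, 1))"
    \<comment> \<open>\<open>K\<close> covers both cases of \<open>\<Gamma>\<close>. The complement
      of \<open>\<Gamma>\<close> is then \<open>A\<close>, where the exponents are at least
      \<open>- \<delta>\<^sub>1\<close>, together with the degrees above \<open>K\<close>.\<close>
    define K where "K = max M N"
    define A where "A = T K - G"
    have c_nn: "\<forall>p\<in>Omega. c p \<ge> 0" and rho: "rho_of c = \<rho>" and sigma: "sigma_of c = \<sigma>"
      and s: "(\<lambda>p. real (fst p + snd p) * c p) summable_on Omega"
      using c by (simp_all add: X_plus_at_def X_plus_def case_prod_unfold)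
    have s1: "(\<lambda>p. real (fst p) * c p) summable_on Omega"
      by (rule summable_on_comparison_test[OF s]) (use c_nn in \<open>auto intro!: mult_right_mono\<close>)
    have s2: "(\<lambda>p. real (snd p) * c p) summable_on Omega"
      by (rule summable_on_comparison_test[OF s]) (use c_nn in \<open>auto intro!: mult_right_mono\<close>)
    have total1: "(\<Sum>\<^sub>\<infinity>p\<in>Omega. real (fst p) * c p) = \<rho>"
      and total2: "(\<Sum>\<^sub>\<infinity>p\<in>Omega. real (snd p) * c p) = \<sigma>"
      using rho sigma by (simp_all add: rho_of_eq sigma_of_eq)
    have total: "(\<Sum>\<^sub>\<infinity>p\<in>Omega. real (fst p + snd p) * c p) = \<rho> + \<sigma>"
      using infsum_add[OF s1 s2] total1 total2 by (simp add: algebra_simps)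
    have finT: "finite (T k)" for k by (simp add: T_def finite_degree_le)
    have le_total: "sum g P \<le> infsum g Omega" if "g summable_on Omega" "finite P" "P \<subseteq> Omega"
      "\<And>p. p \<in> Omega \<Longrightarrow> g p \<ge> 0" for g :: "nat \<times> nat \<Rightarrow> real" and P
      using that by (intro finite_sum_le_infsum) auto
    have "c (1, 0) \<le> \<rho>"
      using le_total[OF s1, of "{(1, 0)}"] c_nn total1 by (simp add: Omega_def)
    \<comment> \<open>Monomer concentrations may be arbitrarily small, so \<open>\<alpha>\<close>
      and \<open>\<beta>\<close> are bounded from above only; in the end they must carry nonnegative
      coefficients.\<close>
    then have "\<alpha> \<le> ln \<rho>" using c by (simp add: \<alpha>_def)
    have "c (0, 1) \<le> \<sigma>"
      using le_total[OF s2, of "{(0, 1)}"] c_nn total2 by (simp add: Omega_def)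
    then have "\<beta> \<le> ln \<sigma>" using c by (simp add: \<beta>_def)
    have c_le_1: "c p \<le> 1" if p: "p \<in> Omega" "M < fst p + snd p" for p
    proof -
      have "real (fst p + snd p) * c p \<le> \<rho> + \<sigma>"
        using le_total[OF s, of "{p}"] c_nn total p by simp
      also have "\<dots> \<le> real (fst p + snd p)" using M(3) p(2) by linarith
      also have "\<dots> = real (fst p + snd p) * 1" by simp
      finally show ?thesis using p(2) by (subst (asm) mult_le_cancel_left_pos) auto
    qed

    have G_sub: "T M \<subseteq> G" "G \<subseteq> T K"
      by (auto simp: G Gamma_set_def T_def K_def)
    have TO: "T k \<subseteq> Omega" for k by (auto simp: T_def)
    have finG: "finite G" using finite_subset[OF G_sub(2) finT] .
    have G_O: "G \<subseteq> Omega" using G_sub(2) TO by blast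
    have one: "(1, 0) \<in> G" "(0, 1) \<in> G"
      using M(2) by (auto intro!: subsetD[OF G_sub(1)] simp: T_def Omega_def)
    have QG: "\<forall>p\<in>G. Q p > 0" using Q_pos G_O by blast
    have A: "M < fst p + snd p \<and> - \<delta>\<^sub>1 * real (fst p + snd p) \<le> ln (b p)" if "p \<in> A" for p
    proof -
      obtain r s where rs: "p = (r, s)" by force
      have *: "p \<in> Omega" "p \<notin> G" "r + s \<le> K" using that rs by (auto simp: A_def T_def)
      then have "M < r + s" by (auto simp: G Gamma_set_def rs)
      with * have "r + s \<le> N" by (simp add: K_def)
      with * \<open>M < r + s\<close> have "- \<delta>\<^sub>1 \<le> ln (b (r, s) powr (1 / real (r + s)))"
        by (auto simp: G Gamma_set_def rs)
      moreover have "b p > 0" using * Q_pos c by (auto simp: b intro: cbar_pos)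
      ultimately have "- \<delta>\<^sub>1 \<le> ln (b p) / real (r + s)" by (simp add: ln_powr rs)
      moreover have "real (r + s) > 0" using \<open>M < r + s\<close> by linarith
      ultimately have "- \<delta>\<^sub>1 * real (r + s) \<le> ln (b p)"
        by (simp add: pos_le_divide_eq del: of_nat_add)
      with \<open>M < r + s\<close> show ?thesis by (simp add: rs)
    qed

    define \<rho>N \<sigma>N where "\<rho>N = rho_upto N c" and "\<sigma>N = sigma_upto N c"
    have TN: "{p. 1 \<le> fst p + snd p \<and> fst p + snd p \<le> N} = T N"
      by (auto simp: T_def Omega_def)
    have \<rho>N: "\<rho>N = (\<Sum>p\<in>T N. real (fst p) * c p)" and \<sigma>N: "\<sigma>N = (\<Sum>p\<in>T N. real (snd p) * c p)"
      unfolding \<rho>N_def \<sigma>N_def rho_upto_def sigma_upto_def case_prod_unfold TN by simp_all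
    have U_sub: "U k \<subseteq> Omega" for k by (auto simp: U_def)
    have s_U: "(\<lambda>p. real (fst p + snd p) * c p) summable_on U k" for k
      by (rule summable_on_subset_banach[OF s U_sub])
    have "(\<Sum>\<^sub>\<infinity>p\<in>U N. real (fst p) * c p) \<le> (\<Sum>\<^sub>\<infinity>p\<in>U N. real (fst p + snd p) * c p)"
      using c_nn U_sub by (intro infsum_mono s_U summable_on_subset_banach[OF s1 U_sub] mult_right_mono) auto
    then have \<rho>N_ge: "\<rho> - \<rho>N \<le> \<delta>\<^sub>2"
      using infsum_degree_split[OF s1, of N] small total1 by (simp add: \<rho>N T_def U_def)
    have "(\<Sum>\<^sub>\<infinity>p\<in>U N. real (snd p) * c p) \<le> (\<Sum>\<^sub>\<infinity>p\<in>U N. real (fst p + snd p) * c p)"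
      using c_nn U_sub by (intro infsum_mono s_U summable_on_subset_banach[OF s2 U_sub] mult_right_mono) auto
    then have \<sigma>N_ge: "\<sigma> - \<sigma>N \<le> \<delta>\<^sub>2"
      using infsum_degree_split[OF s2, of N] small total2 by (simp add: \<sigma>N T_def U_def)
    \<comment> \<open>These exceed \<open>\<rho>N\<close> and \<open>\<sigma>N\<close> only if
      \<open>M > N\<close>; the gap is part of the mass above \<open>N\<close>, hence at most
      \<open>\<delta>\<^sub>2\<close>.\<close>
    define \<rho>K \<sigma>K where "\<rho>K = (\<Sum>p\<in>T K. real (fst p) * c p)" and "\<sigma>K = (\<Sum>p\<in>T K. real (snd p) * c p)"
    have "T N \<subseteq> T K" by (auto simp: T_def K_def)
    then have NK: "\<rho>N \<le> \<rho>K" "\<sigma>N \<le> \<sigma>K"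
      unfolding \<rho>N \<sigma>N \<rho>K_def \<sigma>K_def using c_nn TO by (auto intro!: sum_mono2 finT mult_nonneg_nonneg)
    have K_le: "\<rho>K \<le> \<rho>" "\<sigma>K \<le> \<sigma>"
      unfolding \<rho>K_def \<sigma>K_def using c_nn total1 total2
      by (auto intro!: order_trans[OF le_total[OF s1 finT TO]] order_trans[OF le_total[OF s2 finT TO]])
    have "real (fst (1::nat, 0::nat)) * c (1, 0) \<le> \<rho>N"
      unfolding \<rho>N using c_nn TO \<open>N \<ge> 1\<close>
      by (intro member_le_sum finT) (auto simp: T_def Omega_def)
    then have "\<rho>N > 0" using c by simp
    have "real (snd (0::nat, 1::nat)) * c (0, 1) \<le> \<sigma>N"
      unfolding \<sigma>N using c_nn TO \<open>N \<ge> 1\<close>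
      by (intro member_le_sum finT) (auto simp: T_def Omega_def)
    then have "\<sigma>N > 0" using c by simp

    obtain x' y' where cbar_fin_d: "cbar_fin Q G \<rho>N \<sigma>N = cbar Q (exp x') (exp y')"
      and d1: "(\<Sum>p\<in>G. real (fst p) * cbar Q (exp x') (exp y') p) = \<rho>N"
      and d2: "(\<Sum>p\<in>G. real (snd p) * cbar Q (exp x') (exp y') p) = \<sigma>N"
      using cbar_fin_eq_exp[OF finG one QG Q_10 Q_01 \<open>\<rho>N > 0\<close> \<open>\<sigma>N > 0\<close>] by blast
    define d where "d = cbar Q (exp x') (exp y')"
    define e where "e = cbar Q z w"
    define \<rho>G \<sigma>G where "\<rho>G = (\<Sum>p\<in>G. real (fst p) * c p)" and "\<sigma>G = (\<Sum>p\<in>G. real (snd p) * c p)"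
    have H1: "H_fin G c b - H_fin G c e = \<rho>G * (x - \<alpha>) + \<sigma>G * (y - \<beta>) + sum b G - sum e G"
      unfolding b e_def \<rho>G_def \<sigma>G_def x_def y_def \<alpha>_def \<beta>_def
      using QG c_nn G_O c \<open>z > 0\<close> \<open>w > 0\<close> by (intro H_fin_cbar_diff) auto
    \<comment> \<open>The difference identity with \<open>d\<close> also as reference yields the
      entropy of the finite steady state, because its entropy relative to itself is 0.\<close>
    have "H_fin G d b - H_fin G d d = \<rho>N * (x' - \<alpha>) + \<sigma>N * (y' - \<beta>) + sum b G - sum d G"
      using H_fin_cbar_diff[of G Q d "c (1, 0)" "c (0, 1)" "exp x'" "exp y'"] QG c d1 d2
      by (simp add: d_def b \<alpha>_def \<beta>_def cbar_pos less_imp_le)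
    moreover have "H_fin G d d = 0"
      using QG by (intro H_fin_self) (simp add: d_def cbar_pos)
    ultimately have H2: "H_fin G d b = \<rho>N * (x' - \<alpha>) + \<sigma>N * (y' - \<beta>) + sum b G - sum d G"
      by simp

    \<comment> \<open>Replacing \<open>ln (e p)\<close> by \<open>ln (b p)\<close> costs the terms
      in \<open>\<alpha> - x\<close> and \<open>\<beta> - y\<close>; on \<open>A\<close> the
      remaining \<open>- ln (b p)\<close> is at most \<open>\<delta>\<^sub>1\<close> times the
      degree.\<close>
    define \<tau> where "\<tau> = (\<lambda>p. (\<alpha> - x) * (real (fst p) * c p) + (\<beta> - y) * (real (snd p) * c p)
      + \<delta>\<^sub>1 * (real (fst p + snd p) * c p))"
    define h where "h = (\<lambda>p. if p \<in> T K then \<tau> p else L * (real (fst p + snd p) * c p))"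
    have lnQ: "ln (e p) = real (fst p) * x + real (snd p) * y + ln (Q p)" if "p \<in> Omega" for p
      using Q_pos that \<open>z > 0\<close> \<open>w > 0\<close> by (simp add: e_def ln_cbar x_def y_def)
    have h_ge: "- c p * ln (e p) \<le> h p" if p: "p \<in> Omega - G" for p
    proof (cases "p \<in> T K")
      case True
      then have "p \<in> A" using p by (simp add: A_def)
      have "ln (b p) = real (fst p) * \<alpha> + real (snd p) * \<beta> + ln (Q p)"
        using Q_pos p c by (simp add: b ln_cbar \<alpha>_def \<beta>_def)
      then have "- ln (e p) \<le> (\<alpha> - x) * real (fst p) + (\<beta> - y) * real (snd p)
          + \<delta>\<^sub>1 * real (fst p + snd p)"
        using A[OF \<open>p \<in> A\<close>] lnQ[of p] p by (simp add: algebra_simps)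
      then have "c p * - ln (e p) \<le> c p * ((\<alpha> - x) * real (fst p) + (\<beta> - y) * real (snd p)
          + \<delta>\<^sub>1 * real (fst p + snd p))"
        using c_nn p by (intro mult_left_mono) auto
      then show ?thesis using True by (simp add: h_def \<tau>_def algebra_simps)
    next
      case False
      have "real (fst p) * - x \<le> real (fst p) * \<bar>x\<bar>" "real (snd p) * - y \<le> real (snd p) * \<bar>y\<bar>"
        by (intro mult_left_mono; simp)+
      moreover have "real (fst p) * \<bar>x\<bar> \<le> real (fst p + snd p) * \<bar>x\<bar>"
        "real (snd p) * \<bar>y\<bar> \<le> real (fst p + snd p) * \<bar>y\<bar>"
        by (intro mult_right_mono; simp)+
      moreover have "- ln (Q p) \<le> L0 * real (fst p + snd p)"
        "ln (e p) = real (fst p) * x + real (snd p) * y + ln (Q p)"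
        using p L0 lnQ by auto
      moreover have "L * real (fst p + snd p) = L0 * real (fst p + snd p)
          + real (fst p + snd p) * \<bar>x\<bar> + real (fst p + snd p) * \<bar>y\<bar>"
        by (simp add: L_def algebra_simps)
      ultimately have "- ln (e p) \<le> L * real (fst p + snd p)"
        by linarith
      then have "c p * - ln (e p) \<le> c p * (L * real (fst p + snd p))"
        using c_nn p by (intro mult_left_mono) auto
      then show ?thesis using False by (simp add: h_def algebra_simps)
    qed
    have OG: "Omega - G = A \<union> U K" "A \<inter> U K = {}"
      using G_sub(2) TO[of K] by (auto simp: A_def U_def T_def)
    have finA: "finite A" using finT by (simp add: A_def)
    have h_U: "h p = L * (real (fst p + snd p) * c p)" if "p \<in> U K" for p
      using that by (simp add: h_def U_def T_def)
    have summ_hU: "h summable_on U K"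
      using summable_on_cmult_right[OF s_U, of L K] by (simp add: h_U cong: summable_on_cong)
    have c_OG: "c p \<le> 1" if "p \<in> Omega - G" for p
      using that G_sub(1) by (intro c_le_1) (auto simp: T_def not_le)
    have summ_e: "e summable_on Omega"
      unfolding e_def by (rule summable_on_cbar[OF Q_pos zw_E])
    have H_le: "H c e \<le> ereal (H_fin G c e + infsum e (Omega - G) + infsum h (Omega - G))"
      unfolding e_def
    proof (rule H_le_H_fin_add[OF Q_pos zw_E \<open>z > 0\<close> \<open>w > 0\<close> c_nn finG G_O c_OG])
      show "h summable_on Omega - G"
        unfolding OG(1) by (intro summable_on_Un_disjoint summ_hU OG(2)) (simp add: finA)
    qed (use h_ge in \<open>simp_all add: e_def\<close>)
    have e_split: "infsum e Omega = sum e G + infsum e (Omega - G)"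
    proof -
      have "infsum e (G \<union> (Omega - G)) = infsum e G + infsum e (Omega - G)"
        by (intro infsum_Un_disjoint summable_on_subset_banach[OF summ_e]) (use G_O in auto)
      moreover have "G \<union> (Omega - G) = Omega" using G_O by auto
      ultimately show ?thesis using finG by simp
    qed
    have "infsum h (Omega - G) = sum h A + infsum h (U K)"
      unfolding OG(1) using finA by (simp add: infsum_Un_disjoint summ_hU OG(2))
    moreover have "sum h A = sum \<tau> A"
      by (intro sum.cong) (auto simp: A_def h_def)
    moreover have "infsum h (U K) \<le> L * \<delta>\<^sub>2"
    proof -
      have "infsum h (U K) = L * (\<Sum>\<^sub>\<infinity>p\<in>U K. real (fst p + snd p) * c p)"
        using infsum_cmult_right[OF s_U, of L K] by (simp add: h_U cong: infsum_cong)
      also have "\<dots> \<le> L * (\<Sum>\<^sub>\<infinity>p\<in>U N. real (fst p + snd p) * c p)"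
        using c_nn \<open>L \<ge> 0\<close>
        by (intro mult_left_mono infsum_mono2 s_U) (auto simp: U_def K_def)
      also have "\<dots> \<le> L * \<delta>\<^sub>2" using small \<open>L \<ge> 0\<close> by (intro mult_left_mono)
      finally show ?thesis .
    qed
    ultimately have h_le: "infsum h (Omega - G) \<le> sum \<tau> A + L * \<delta>\<^sub>2" by linarith
    have split_TK: "sum g (T K) = sum g A + sum g G" for g :: "nat \<times> nat \<Rightarrow> real"
      unfolding A_def using sum.subset_diff[OF G_sub(2) finT] .
    have "(\<Sum>p\<in>A. real (fst p + snd p) * c p) \<le> \<rho> + \<sigma>"
      using le_total[OF s finA] c_nn TO[of K] total by (auto simp: A_def)
    then have "\<delta>\<^sub>1 * (\<Sum>p\<in>A. real (fst p + snd p) * c p) \<le> \<epsilon> / 4"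
      unfolding \<delta>\<^sub>1_eq[symmetric] using \<open>\<delta>\<^sub>1 > 0\<close> by (intro mult_left_mono) auto
    \<comment> \<open>The moments over \<open>A\<close> are those over \<open>T K\<close> minus
      those over \<open>G\<close>; the latter part will cancel the \<open>\<rho>G\<close> and
      \<open>\<sigma>G\<close> terms of \<open>H1\<close>.\<close>
    then have \<tau>_le: "sum \<tau> A \<le> (\<alpha> - x) * (\<rho>K - \<rho>G) + (\<beta> - y) * (\<sigma>K - \<sigma>G) + \<epsilon> / 4"
      using split_TK[of "\<lambda>p. real (fst p) * c p"] split_TK[of "\<lambda>p. real (snd p) * c p"]
      by (simp add: \<tau>_def sum.distrib \<rho>K_def \<sigma>K_def \<rho>G_def \<sigma>G_def flip: sum_distrib_left)

    \<comment> \<open>The set \<open>\<Gamma>\<close> depends on \<open>c\<close>, but it contains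
      \<open>T M\<close>, where the lower bound is uniform; enlarging the index set only increases
      the partition sum.\<close>
    have "F - \<epsilon> / 2 \<le> free_energy Q (T M) \<rho>N \<sigma>N x' y'"
      using \<rho>N_ge \<sigma>N_ge \<delta>\<^sub>2_le(2) NK K_le M(1) by (intro n) linarith+
    also have "\<dots> \<le> sum d G - \<rho>N * x' - \<sigma>N * y'"
    proof -
      have "sum d (T M) \<le> sum d G"
        using G_sub(1) finG QG by (intro sum_mono2) (auto simp: d_def intro!: less_imp_le cbar_pos)
      then show ?thesis by (simp add: free_energy_finite finT d_def)
    qed
    finally have F_le: "F - \<epsilon> / 2 \<le> sum d G - \<rho>N * x' - \<sigma>N * y'" .
    have F_eq: "F = infsum e Omega - \<rho> * x - \<sigma> * y"
      using \<open>z > 0\<close> \<open>w > 0\<close> by (simp add: F_def free_energy_def e_def x_def y_def)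
    have abs_le: "u * t \<le> \<delta>\<^sub>2 * \<bar>t\<bar>" if "0 \<le> u" "u \<le> \<delta>\<^sub>2" for u t :: real
    proof -
      have "u * t \<le> u * \<bar>t\<bar>" using that by (intro mult_left_mono) auto
      also have "\<dots> \<le> \<delta>\<^sub>2 * \<bar>t\<bar>" using that by (intro mult_right_mono) auto
      finally show ?thesis .
    qed
    have "(\<rho> - \<rho>N) * x \<le> \<delta>\<^sub>2 * \<bar>x\<bar>" "(\<sigma> - \<sigma>N) * y \<le> \<delta>\<^sub>2 * \<bar>y\<bar>"
      using \<rho>N_ge \<sigma>N_ge NK K_le by (intro abs_le; linarith)+
    moreover have "(\<rho>K - \<rho>N) * (\<alpha> - x) \<le> \<delta>\<^sub>2 * \<bar>x - ln \<rho>\<bar>"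
    proof -
      have "(\<rho>K - \<rho>N) * (\<alpha> - x) \<le> (\<rho>K - \<rho>N) * (ln \<rho> - x)"
        using NK \<open>\<alpha> \<le> ln \<rho>\<close> by (intro mult_left_mono) auto
      also have "\<dots> \<le> \<delta>\<^sub>2 * \<bar>ln \<rho> - x\<bar>"
        using \<rho>N_ge NK K_le by (intro abs_le) linarith+
      finally show ?thesis by (simp add: abs_minus_commute)
    qed
    moreover have "(\<sigma>K - \<sigma>N) * (\<beta> - y) \<le> \<delta>\<^sub>2 * \<bar>y - ln \<sigma>\<bar>"
    proof -
      have "(\<sigma>K - \<sigma>N) * (\<beta> - y) \<le> (\<sigma>K - \<sigma>N) * (ln \<sigma> - y)"
        using NK \<open>\<beta> \<le> ln \<sigma>\<close> by (intro mult_left_mono) auto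
      also have "\<dots> \<le> \<delta>\<^sub>2 * \<bar>ln \<sigma> - y\<bar>"
        using \<sigma>N_ge NK K_le by (intro abs_le) linarith+
      finally show ?thesis by (simp add: abs_minus_commute)
    qed
    moreover have "L * \<delta>\<^sub>2 + \<delta>\<^sub>2 * \<bar>x\<bar> + \<delta>\<^sub>2 * \<bar>y\<bar> + \<delta>\<^sub>2 * \<bar>x - ln \<rho>\<bar> + \<delta>\<^sub>2 * \<bar>y - ln \<sigma>\<bar> \<le> \<epsilon> / 4"
      using \<delta>\<^sub>2_le(1) by (simp add: D_def algebra_simps)
    \<comment> \<open>In the sum of all entropies \<open>sum b G\<close> cancels, and
      \<open>sum e G\<close> is completed to the sum over \<open>Omega\<close>. The monomer
      logarithms survive only in \<open>(\<rho>K - \<rho>N) * (\<alpha> - x)\<close> and its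
      analogue for \<open>\<sigma>\<close>, and \<open>F_le\<close> compares the remaining free
      energies.\<close>
    ultimately have "H_fin G c e + infsum e (Omega - G) + infsum h (Omega - G) + H_fin G d b - \<epsilon>
        \<le> H_fin G c b"
      using H1 H2 e_split h_le \<tau>_le F_le F_eq by (simp add: algebra_simps)
    then have "ereal (H_fin G c e + infsum e (Omega - G) + infsum h (Omega - G))
        + ereal (H_fin G d b) - ereal \<epsilon> \<le> ereal (H_fin G c b)" by simp
    with H_le have "H c e + ereal (H_fin G d b) - ereal \<epsilon> \<le> ereal (H_fin G c b)"
      by (meson add_right_mono ereal_minus_mono order_refl order_trans)
    then show ?thesis
      by (simp add: cbar_fin_d d_def e_def flip: \<rho>N_def \<sigma>N_def)
  qed
  have tail: "(\<Sum>\<^sub>\<infinity>(r, s)\<in>{(r, s)\<in>Omega. r + s \<ge> N + 1}. real (r + s) * c (r, s))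
      = (\<Sum>\<^sub>\<infinity>p\<in>U N. real (fst p + snd p) * c p)" for N c
    by (rule infsum_cong_neutral) (auto simp: U_def)
  show "\<exists>(M::nat) \<delta>1 \<delta>2. M \<ge> 1 \<and> \<delta>1 > 0 \<and> \<delta>2 > 0 \<and>
    (\<forall>(N::nat) c. N \<ge> 1 \<and> c \<in> X_plus_at \<rho> \<sigma> \<and> c (1, 0) > 0 \<and> c (0, 1) > 0 \<and>
        (\<Sum>\<^sub>\<infinity>(r, s)\<in>{(r, s)\<in>Omega. r + s \<ge> N + 1}. real (r + s) * c (r, s)) \<le> \<delta>2 \<longrightarrow>
      (let b = cbar Q (c (1, 0)) (c (0, 1));
           \<Gamma> = Gamma_set b M N \<delta>1
       in ereal (H_fin \<Gamma> c b) \<ge>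
            H c (cbar Q z w)
          + ereal (H_fin \<Gamma> (cbar_fin Q \<Gamma> (rho_upto N c) (sigma_upto N c)) b)
          - ereal \<epsilon>))"
    unfolding tail Let_def
  proof (intro exI conjI allI impI)
    fix N c
    assume *: "1 \<le> N \<and> c \<in> X_plus_at \<rho> \<sigma> \<and> 0 < c (1, 0) \<and> 0 < c (0, 1) \<and>
      (\<Sum>\<^sub>\<infinity>p\<in>U N. real (fst p + snd p) * c p) \<le> \<delta>\<^sub>2"
    let ?b = "cbar Q (c (1, 0)) (c (0, 1))"
    let ?G = "Gamma_set ?b M N \<delta>\<^sub>1"
    show "H c (cbar Q z w) + ereal (H_fin ?G (cbar_fin Q ?G (rho_upto N c) (sigma_upto N c)) ?b)
        - ereal \<epsilon> \<le> ereal (H_fin ?G c ?b)"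
      by (rule main[OF _ _ _ _ _ refl refl]) (use * in auto)
  qed (fact M(2) \<open>\<delta>\<^sub>1 > 0\<close> \<open>\<delta>\<^sub>2 > 0\<close>)+
qed

end
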